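(* Let $\mathbb F$ be a non-archimedean valued field, $X$ a nonempty set, $d$ an ultra-pseudometric on $\overline X=X\cup\{\mathbf 0\}$, and $\|\cdot\|$ the Kantorovich ultra-seminorm for $d$ on $L_{\mathbb F}(X)$. Then the infimum formulas for $\|\cdot\|$ over the support are in fact minima: for every $u\in L_{\mathbb F}(X)$, $$\|u\|=\min\Big\{\max_{1\le i\le k}|s_i|\,d(x_i,y_i): u=\sum_{i=1}^k s_i(x_i-y_i),\ x_i,y_i\in\operatorname{supp}(u),\ s_i\in\mathbb F\Big\},$$ and, if $u=\sum_{i=1}^n\lambda_ix_i$ is a normal form of $u$, $m=|\operatorname{supp}(u)|$ and $\operatorname{supp}(u)=\{x_1,\dots,x_m\}$, $$\|u\|=\min\Big\{\max_{1\le i,j\le m}|c_{ij}|\,d(x_i,x_j): c_{ij}\in\mathbb F,\ c_{ii}=0_{\mathbb F},\ \sum_{j=1}^m c_{ij}-\sum_{j=1}^m c_{ji}=\lambda_i\ \text{ for all }1\le i\le n\Big\}.$$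
   Context: $L_{\mathbb F}(X)$ is the free $\mathbb F$-vector space on the nonempty set $X$; $\mathbf 0\notin X$ is its zero vector and $\overline X:=X\cup\{\mathbf 0\}\subseteq L_{\mathbb F}(X)$. $L^0_{\mathbb F}(X)$ is the kernel of the functional $\sum\lambda_ix_i\mapsto\sum\lambda_i$. Normal form and support: every nonzero $u\in L_{\mathbb F}(X)$ is written $u=\sum_{i=1}^n\lambda_ix_i$ with the $x_i\in X$ pairwise distinct and all $\lambda_i\ne 0_{\mathbb F}$. If $u\in L^0_{\mathbb F}(X)$, $\operatorname{supp}(u):=\{x_1,\dots,x_n\}$ (so $m=n$); otherwise $\operatorname{supp}(u):=\{x_1,\dots,x_n,x_{n+1}\}$ with $x_{n+1}=\mathbf 0$ (so $m=n+1$). $\operatorname{supp}(\mathbf 0):=\{\mathbf 0\}$. A non-archimedean valued field is a field with a valuation $|\cdot|:\mathbb F\to[0,\infty)$ with $|x|=0\iff x=0$, $|xy|=|x||y|$, $|x+y|\le\max\{|x|,|y|\}$ (the trivial valuation is allowed). An ultra-pseudometric is a pseudometric with $d(x,z)\le\max\{d(x,y),d(y,z)\}$. An ultra-seminorm on an $\mathbb F$-vector space is a map $p\ge0$ with $p(0)=0$, $p(x+y)\le\max\{p(x),p(y)\}$, $p(\alpha x)=|\alpha|p(x)$. The Kantorovich ultra-seminorm for $d$ is the (pointwise) maximal ultra-seminorm $p$ on $L_{\mathbb F}(X)$ with $p(x-y)=d(x,y)$ for all $x,y\in\overline X$; it exists and is given by $$\|u\|=\inf\Big\{\max_{1\le i\le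 k}|s_i|d(a_i,b_i): u=\sum_{i=1}^k s_i(a_i-b_i),\ a_i,b_i\in\overline X,\ s_i\in\mathbb F\Big\}.$$ *)

theory Defs
  imports Complex_Main "HOL-Library.Poly_Mapping"
begin

text \<open>Vectors of the free vector space on \<open>X\<close> are finitely supported functions
  \<open>'a \<Rightarrow>\<^sub>0 'f\<close> whose \<^const>\<open>Poly_Mapping.keys\<close> lie in the carrier set \<open>X\<close>.\<close>

definition free_space :: "'a set \<Rightarrow> ('a \<Rightarrow>\<^sub>0 'f::field) set"
  where "free_space X = {u. Poly_Mapping.keys u \<subseteq> X}"

definition smul :: "'f::field \<Rightarrow> ('a \<Rightarrow>\<^sub>0 'f) \<Rightarrow> ('a \<Rightarrow>\<^sub>0 'f)"
  where "smul c u = Poly_Mapping.map ((*) c) u"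

definition basis_vec :: "'a \<Rightarrow> ('a \<Rightarrow>\<^sub>0 'f::field)"
  where "basis_vec x = Poly_Mapping.single x 1"

text \<open>\<open>X\<close> is identified with its image under \<^const>\<open>basis_vec\<close>, so that
  \<open>X \<union> {0}\<close> literally is a set of vectors.\<close>

definition pointed :: "'a set \<Rightarrow> ('a \<Rightarrow>\<^sub>0 'f::field) set"
  where "pointed X = insert 0 (basis_vec ` X)"

definition coeff_sum :: "('a \<Rightarrow>\<^sub>0 'f::field) \<Rightarrow> 'f"
  where "coeff_sum u = (\<Sum>x\<in>Poly_Mapping.keys u. Poly_Mapping.lookup u x)"

text \<open>The kernel of \<^const>\<open>coeff_sum\<close> on \<^term>\<open>free_space X\<close> is \<open>L\<^sup>0(X)\<close>; outside it the zero
  vector belongs to the support.\<close>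

definition supp :: "('a \<Rightarrow>\<^sub>0 'f::field) \<Rightarrow> ('a \<Rightarrow>\<^sub>0 'f) set"
  where "supp u =
    (if u = 0 then {0}
     else if coeff_sum u = 0 then basis_vec ` Poly_Mapping.keys u
     else insert 0 (basis_vec ` Poly_Mapping.keys u))"

text \<open>The case \<open>n = 0\<close> (empty sum) is the normal form of the zero vector.\<close>

definition normal_form ::
  "'a set \<Rightarrow> ('a \<Rightarrow>\<^sub>0 'f::field) \<Rightarrow> nat \<Rightarrow> (nat \<Rightarrow> 'f) \<Rightarrow> (nat \<Rightarrow> ('a \<Rightarrow>\<^sub>0 'f)) \<Rightarrow> bool"
  where "normal_form X u n lam x \<longleftrightarrow>
    (\<forall>i\<in>{1..n}. x i \<in> basis_vec ` X \<and> lam i \<noteq> 0) \<and>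
    inj_on x {1..n} \<and>
    u = (\<Sum>i=1..n. smul (lam i) (x i))"

definition nonarch_valuation :: "('f::field \<Rightarrow> real) \<Rightarrow> bool"
  where "nonarch_valuation val \<longleftrightarrow>
    (\<forall>x. val x \<ge> 0) \<and>
    (\<forall>x. val x = 0 \<longleftrightarrow> x = 0) \<and>
    (\<forall>x y. val (x * y) = val x * val y) \<and>
    (\<forall>x y. val (x + y) \<le> max (val x) (val y))"

definition ultra_pseudometric_on :: "'b set \<Rightarrow> ('b \<Rightarrow> 'b \<Rightarrow> real) \<Rightarrow> bool"
  where "ultra_pseudometric_on S d \<longleftrightarrow>
    (\<forall>x\<in>S. \<forall>y\<in>S. d x y \<ge> 0) \<and>
    (\<forall>x\<in>S. d x x = 0) \<and>
    (\<forall>x\<in>S. \<forall>y\<in>S. d x y = d y x) \<and>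
    (\<forall>x\<in>S. \<forall>y\<in>S. \<forall>z\<in>S. d x z \<le> max (d x y) (d y z))"

definition ultra_seminorm ::
  "('f::field \<Rightarrow> real) \<Rightarrow> 'a set \<Rightarrow> (('a \<Rightarrow>\<^sub>0 'f) \<Rightarrow> real) \<Rightarrow> bool"
  where "ultra_seminorm val X p \<longleftrightarrow>
    (\<forall>u\<in>free_space X. p u \<ge> 0) \<and>
    p 0 = 0 \<and>
    (\<forall>u\<in>free_space X. \<forall>v\<in>free_space X. p (u + v) \<le> max (p u) (p v)) \<and>
    (\<forall>c. \<forall>u\<in>free_space X. p (smul c u) = val c * p u)"

definition extends_metric ::
  "'a set \<Rightarrow> (('a \<Rightarrow>\<^sub>0 'f::field) \<Rightarrow> ('a \<Rightarrow>\<^sub>0 'f) \<Rightarrow> real) \<Rightarrow> (('a \<Rightarrow>\<^sub>0 'f) \<Rightarrow> real) \<Rightarrow> bool"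
  where "extends_metric X d p \<longleftrightarrow> (\<forall>x\<in>pointed X. \<forall>y\<in>pointed X. p (x - y) = d x y)"

text \<open>The values of \<open>p\<close> outside \<^term>\<open>free_space X\<close> are irrelevant; on it, \<open>p\<close> is
  determined uniquely by maximality.\<close>

definition kantorovich_seminorm ::
  "('f::field \<Rightarrow> real) \<Rightarrow> 'a set \<Rightarrow> (('a \<Rightarrow>\<^sub>0 'f) \<Rightarrow> ('a \<Rightarrow>\<^sub>0 'f) \<Rightarrow> real)
    \<Rightarrow> (('a \<Rightarrow>\<^sub>0 'f) \<Rightarrow> real) \<Rightarrow> bool"
  where "kantorovich_seminorm val X d p \<longleftrightarrow>
    ultra_seminorm val X p \<and> extends_metric X d p \<and>
    (\<forall>q. ultra_seminorm val X q \<and> extends_metric X d q \<longrightarrow> (\<forall>u\<in>free_space X. q u \<le> p u))"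

text \<open>Requiring \<open>k \<ge> 1\<close> loses nothing, since a summand with \<open>s i = 0\<close> is allowed; it keeps
  \<^const>\<open>Max\<close> away from the empty set.\<close>

definition rep_costs ::
  "('f::field \<Rightarrow> real) \<Rightarrow> (('a \<Rightarrow>\<^sub>0 'f) \<Rightarrow> ('a \<Rightarrow>\<^sub>0 'f) \<Rightarrow> real)
    \<Rightarrow> ('a \<Rightarrow>\<^sub>0 'f) set \<Rightarrow> ('a \<Rightarrow>\<^sub>0 'f) \<Rightarrow> real set"
  where "rep_costs val d A u =
    {Max ((\<lambda>i. val (s i) * d (a i) (b i)) ` {1..k}) | (k::nat) s a b.
       k \<ge> 1 \<and> (\<forall>i\<in>{1..k}. a i \<in> A \<and> b i \<in> A) \<and>
       u = (\<Sum>i=1..k. smul (s i) (a i - b i))}"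

definition matrix_costs ::
  "('f::field \<Rightarrow> real) \<Rightarrow> (('a \<Rightarrow>\<^sub>0 'f) \<Rightarrow> ('a \<Rightarrow>\<^sub>0 'f) \<Rightarrow> real)
    \<Rightarrow> nat \<Rightarrow> (nat \<Rightarrow> 'f) \<Rightarrow> nat \<Rightarrow> (nat \<Rightarrow> ('a \<Rightarrow>\<^sub>0 'f)) \<Rightarrow> real set"
  where "matrix_costs val d n lam m x =
    {Max ((\<lambda>(i, j). val (c i j) * d (x i) (x j)) ` ({1..m} \<times> {1..m})) | c.
       (\<forall>i\<in>{1..m}. c i i = 0) \<and>
       (\<forall>i\<in>{1..n}. (\<Sum>j=1..m. c i j) - (\<Sum>j=1..m. c j i) = lam i)}"

definition is_minimum :: "real \<Rightarrow> real set \<Rightarrow> bool"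
  where "is_minimum r S \<longleftrightarrow> r \<in> S \<and> (\<forall>t\<in>S. r \<le> t)"

lemma lookup_smul [simp]: "Poly_Mapping.lookup (smul c u) x = c * Poly_Mapping.lookup u x"
  by (simp add: smul_def Poly_Mapping.map.rep_eq when_def)

lemma vector_space_smul: "vector_space (smul :: 'f::field \<Rightarrow> ('a \<Rightarrow>\<^sub>0 'f) \<Rightarrow> _)"
  by unfold_locales (rule poly_mapping_eqI; simp add: lookup_add algebra_simps)+

lemma smul_zero [simp]: "smul c 0 = 0"
  by (rule poly_mapping_eqI) simp

lemma free_space_zero: "0 \<in> free_space X"
  and free_space_add: "u \<in> free_space X \<Longrightarrow> v \<in> free_space X \<Longrightarrow> u + v \<in> free_space X"
  and free_space_smul: "u \<in> free_space X \<Longrightarrow> smul c u \<in> free_space X"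
  by (auto simp: free_space_def subset_iff in_keys_iff lookup_add) (metis add.right_neutral)

lemma pointed_subset: "pointed X \<subseteq> free_space X"
  by (auto simp: pointed_def free_space_def basis_vec_def)

lemma free_space_diff: "u \<in> free_space X \<Longrightarrow> v \<in> free_space X \<Longrightarrow> u - v \<in> free_space X"
  by (auto simp: free_space_def subset_iff in_keys_iff lookup_minus) (metis diff_zero)

lemma rep_costsI:
  assumes "k \<ge> 1" "\<And>i. i \<in> {1..k} \<Longrightarrow> a i \<in> A \<and> b i \<in> A"
    "u = (\<Sum>i=1..k. smul (s i) (a i - b i))"
  shows "Max ((\<lambda>i. val (s i) * d (a i) (b i)) ` {1..k::nat}) \<in> rep_costs val d A u"
  unfolding rep_costs_def using assms by blast

lemma rep_costs_diff:
  assumes "x \<in> A" "y \<in> A"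
  shows "val c * d x y \<in> rep_costs val d A (smul c (x - y))"
  using rep_costsI[of 1 "\<lambda>_. x" A "\<lambda>_. y" "smul c (x - y)" "\<lambda>_. c" val d] assms by simp

lemma rep_costs_add:
  assumes "r \<in> rep_costs val d A u" "t \<in> rep_costs val d A v"
  shows "max r t \<in> rep_costs val d A (u + v)"
proof -
  obtain k s a b where k: "k \<ge> (1::nat)" "\<forall>i\<in>{1..k}. a i \<in> A \<and> b i \<in> A"
    "u = (\<Sum>i=1..k. smul (s i) (a i - b i))"
    "r = Max ((\<lambda>i. val (s i) * d (a i) (b i)) ` {1..k})"
    using assms(1) unfolding rep_costs_def by blast
  obtain l s' a' b' where l: "l \<ge> (1::nat)" "\<forall>i\<in>{1..l}. a' i \<in> A \<and> b' i \<in> A"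
    "v = (\<Sum>i=1..l. smul (s' i) (a' i - b' i))"
    "t = Max ((\<lambda>i. val (s' i) * d (a' i) (b' i)) ` {1..l})"
    using assms(2) unfolding rep_costs_def by blast
  define S where "S i = (if i \<le> k then s i else s' (i - k))" for i
  define P where "P i = (if i \<le> k then a i else a' (i - k))" for i
  define Q where "Q i = (if i \<le> k then b i else b' (i - k))" for i
  have split: "{1..k + l} = {1..k} \<union> (\<lambda>i. i + k) ` {1..l}"
    by (auto simp: image_iff)
  have disj: "{1..k} \<inter> (\<lambda>i. i + k) ` {1..l} = {}" by auto
  have sum: "u + v = (\<Sum>i=1..k+l. smul (S i) (P i - Q i))"
  proof -
    have "(\<Sum>i\<in>{1..k}. smul (S i) (P i - Q i)) = u"
      unfolding k(3) by (rule sum.cong) (auto simp: S_def P_def Q_def)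
    moreover have "(\<Sum>i\<in>(\<lambda>i. i + k) ` {1..l}. smul (S i) (P i - Q i)) = v"
      unfolding l(3)
      by (subst sum.reindex) (auto simp: S_def P_def Q_def inj_on_def simp del: image_add_atLeastAtMost' intro!: sum.cong)
    ultimately show ?thesis
      unfolding split using disj
      by (subst sum.union_disjoint) (auto simp del: image_add_atLeastAtMost')
  qed
  let ?g = "\<lambda>i. val (S i) * d (P i) (Q i)"
  have "?g ` {1..k+l} = (\<lambda>i. val (s i) * d (a i) (b i)) ` {1..k} \<union> (\<lambda>i. val (s' i) * d (a' i) (b' i)) ` {1..l}"
    unfolding split image_Un image_image
    by (intro arg_cong2[of _ _ _ _ "(\<union>)"] image_cong) (auto simp: S_def P_def Q_def)
  then have "Max (?g ` {1..k+l}) = max r t"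
    unfolding k(4) l(4) using k(1) l(1) by (simp add: Max_Un)
  moreover have "Max (?g ` {1..k+l}) \<in> rep_costs val d A (u + v)"
  proof (rule rep_costsI[OF _ _ sum])
    fix i assume "i \<in> {1..k+l}"
    then show "P i \<in> A \<and> Q i \<in> A"
    proof (cases "i \<le> k")
      case True
      then show ?thesis using k(2) \<open>i \<in> _\<close> by (simp add: P_def Q_def)
    next
      case False
      then have "i - k \<in> {1..l}" using \<open>i \<in> _\<close> by auto
      with l(2) False show ?thesis by (simp add: P_def Q_def)
    qed
  qed (use k(1) in simp)
  ultimately show ?thesis by simp
qed

lemma rep_costs_smul:
  assumes "nonarch_valuation val" "r \<in> rep_costs val d A u"
  shows "val c * r \<in> rep_costs val d A (smul c u)"
proof -
  interpret vector_space "smul :: 'a \<Rightarrow> ('b \<Rightarrow>\<^sub>0 'a) \<Rightarrow> _" by (rule vector_space_smul)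
  obtain k s a b where k: "k \<ge> (1::nat)" "\<forall>i\<in>{1..k}. a i \<in> A \<and> b i \<in> A"
    "u = (\<Sum>i=1..k. smul (s i) (a i - b i))"
    "r = Max ((\<lambda>i. val (s i) * d (a i) (b i)) ` {1..k})"
    using assms(2) unfolding rep_costs_def by blast
  have m: "mono (\<lambda>x. val c * x)"
    using assms(1) by (auto simp: mono_def nonarch_valuation_def mult_left_mono)
  have "val c * r = Max ((\<lambda>i. val (c * s i) * d (a i) (b i)) ` {1..k})"
    unfolding k(4) using k(1) assms(1)
    by (subst mono_Max_commute[OF m]) (auto simp: image_image nonarch_valuation_def mult.assoc)
  moreover have "\<dots> \<in> rep_costs val d A (smul c u)"
    using k by (intro rep_costsI) (auto simp: scale_sum_right)
  ultimately show ?thesis by simp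
qed

lemma rep_costs_nonempty:
  assumes "u \<in> free_space X"
  shows "rep_costs val d (pointed X) u \<noteq> {}"
proof -
  have *: "rep_costs val d (pointed X) (\<Sum>x\<in>F. Poly_Mapping.single x (f x)) \<noteq> {}"
    if "finite F" "F \<subseteq> X" for F f
    using that
  proof (induction F)
    case empty
    show ?case using rep_costs_diff[of 0 "pointed X" 0 val 0 d]
      by (auto simp: pointed_def)
  next
    case (insert x F)
    have "smul (f x) (basis_vec x - 0) = Poly_Mapping.single x (f x)"
      by (rule poly_mapping_eqI) (simp add: basis_vec_def lookup_single when_def)
    then have "val (f x) * d (basis_vec x) 0 \<in> rep_costs val d (pointed X) (Poly_Mapping.single x (f x))"
      using insert.prems rep_costs_diff[of "basis_vec x" "pointed X" 0 val "f x" d]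
      by (auto simp: pointed_def)
    with insert show ?case by (auto dest: rep_costs_add)
  qed
  have "u = (\<Sum>x\<in>Poly_Mapping.keys u. Poly_Mapping.single x (Poly_Mapping.lookup u x))"
    by (rule poly_mapping_eqI)
      (simp add: lookup_sum lookup_single when_def in_keys_iff)
  then show ?thesis
    using *[of "Poly_Mapping.keys u" "Poly_Mapping.lookup u"] assms by (simp add: free_space_def)
qed

lemma ultra_seminorm_le_rep_cost:
  assumes val: "nonarch_valuation val" and q: "ultra_seminorm val X q"
    and le: "\<And>x y. x \<in> pointed X \<Longrightarrow> y \<in> pointed X \<Longrightarrow> q (x - y) \<le> d x y"
    and r: "r \<in> rep_costs val d (pointed X) u"
  shows "q u \<le> r"
proof -
  obtain k s a b where k: "k \<ge> (1::nat)" "\<forall>i\<in>{1..k}. a i \<in> pointed X \<and> b i \<in> pointed X"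
    "u = (\<Sum>i=1..k. smul (s i) (a i - b i))"
    "r = Max ((\<lambda>i. val (s i) * d (a i) (b i)) ` {1..k})"
    using r unfolding rep_costs_def by blast
  have summand: "smul (s i) (a i - b i) \<in> free_space X \<and> q (smul (s i) (a i - b i)) \<le> r"
    if "i \<in> {1..k}" for i
  proof -
    have ab: "a i \<in> pointed X" "b i \<in> pointed X" using k(2) that by auto
    then have f: "a i - b i \<in> free_space X"
      using pointed_subset by (blast intro: free_space_diff)
    have "q (smul (s i) (a i - b i)) = val (s i) * q (a i - b i)"
      using q f by (auto simp: ultra_seminorm_def)
    also have "\<dots> \<le> val (s i) * d (a i) (b i)"
      using val le[OF ab] by (auto simp: nonarch_valuation_def intro: mult_left_mono)
    also have "\<dots> \<le> r" unfolding k(4) using that by (intro Max_ge) auto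
    finally show ?thesis using f by (auto intro: free_space_smul)
  qed
  have "r \<ge> 0"
    using summand[of 1] k(1) q by (force simp: ultra_seminorm_def)
  have "sum g F \<in> free_space X \<and> q (sum g F) \<le> r"
    if "finite F" "\<And>i. i \<in> F \<Longrightarrow> g i \<in> free_space X \<and> q (g i) \<le> r" for F and g :: "nat \<Rightarrow> _"
    using that
  proof (induction F)
    case empty
    then show ?case using q \<open>r \<ge> 0\<close> by (auto simp: ultra_seminorm_def free_space_zero)
  next
    case (insert i F)
    then have *: "g i \<in> free_space X" "q (g i) \<le> r" "sum g F \<in> free_space X" "q (sum g F) \<le> r"
      by auto
    then have "q (g i + sum g F) \<le> max (q (g i)) (q (sum g F))"
      using q by (auto simp: ultra_seminorm_def)
    with * insert.hyps show ?case by (auto intro: free_space_add)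
  qed
  from this[of "{1..k}" "\<lambda>i. smul (s i) (a i - b i)"] summand show ?thesis
    unfolding k(3) by auto
qed

lemma nonarch_valuation_simps:
  assumes "nonarch_valuation val"
  shows "val 0 = 0" "val 1 = 1" "val (-1) = 1"
proof -
  show "val 0 = 0" using assms by (auto simp: nonarch_valuation_def)
  have m: "val (x * y) = val x * val y" for x y using assms by (auto simp: nonarch_valuation_def)
  have "val 1 \<noteq> 0" using assms by (auto simp: nonarch_valuation_def)
  then show 1: "val 1 = 1" using m[of 1 1] by simp
  have "val (-1) * val (-1) = 1" using m[of "-1" "-1"] 1 by simp
  moreover have "val (-1) \<ge> 0" using assms by (auto simp: nonarch_valuation_def)
  ultimately show "val (-1) = 1" by (metis abs_of_nonneg abs_1 real_sqrt_abs2 real_sqrt_one)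
qed

text \<open>The explicit formula for the Kantorovich ultra-seminorm; it shows in particular that
  \<^const>\<open>kantorovich_seminorm\<close> is satisfiable.\<close>

lemma kantorovich_seminorm_Inf:
  fixes val :: "'f::field \<Rightarrow> real" and X :: "'a set"
  assumes val: "nonarch_valuation val" and d: "ultra_pseudometric_on (pointed X) d"
  shows "kantorovich_seminorm val X d (\<lambda>u. Inf (rep_costs val d (pointed X) u))"
    (is "kantorovich_seminorm _ _ _ ?p")
proof -
  interpret vector_space "smul :: 'f \<Rightarrow> ('a \<Rightarrow>\<^sub>0 'f) \<Rightarrow> _" by (rule vector_space_smul)
  let ?C = "rep_costs val d (pointed X)"
  have z: "0 \<in> pointed X" by (simp add: pointed_def)
  have nn: "val c \<ge> 0" for c using val by (auto simp: nonarch_valuation_def)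
  have "ultra_seminorm val X (\<lambda>_. 0)" by (auto simp: ultra_seminorm_def)
  then have pos: "r \<ge> 0" if "r \<in> ?C u" for r u
    using ultra_seminorm_le_rep_cost[OF val _ _ that, of "\<lambda>_. 0"] d
    by (simp add: ultra_pseudometric_on_def)
  then have bdd: "bdd_below (?C u)" for u by (auto simp: bdd_below_def)
  have ne: "?C u \<noteq> {}" if "u \<in> free_space X" for u using rep_costs_nonempty[OF that] .
  have p_le: "?p u \<le> r" if "r \<in> ?C u" for u r using cInf_lower[OF that bdd] .
  have p_ge: "r \<le> ?p u" if "u \<in> free_space X" "\<And>t. t \<in> ?C u \<Longrightarrow> r \<le> t" for u r
    using cInf_greatest[OF ne] that by blast
  have p0: "?p 0 = 0"
  proof (rule antisym)
    show "?p 0 \<le> 0"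
      using p_le[OF rep_costs_diff[OF z z, where c=0]] nonarch_valuation_simps[OF val] by simp
    show "0 \<le> ?p 0" by (intro p_ge pos free_space_zero)
  qed
  have smul_le: "?p (smul c u) \<le> val c * ?p u" if u: "u \<in> free_space X" and c: "c \<noteq> 0" for c u
  proof -
    have vc: "val c > 0" using val c nn[of c] by (auto simp: nonarch_valuation_def less_le)
    have "?p (smul c u) / val c \<le> ?p u"
    proof (rule p_ge[OF u])
      fix t assume "t \<in> ?C u"
      from p_le[OF rep_costs_smul[OF val this, where c=c]]
      show "?p (smul c u) / val c \<le> t" using vc by (simp add: field_simps)
    qed
    then show ?thesis using vc by (simp add: field_simps)
  qed
  have smul_eq: "?p (smul c u) = val c * ?p u" if u: "u \<in> free_space X" for c u
  proof (cases "c = 0")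
    case True
    then show ?thesis using p0 nonarch_valuation_simps[OF val] by simp
  next
    case False
    have "val c * ?p u \<le> val c * (val (inverse c) * ?p (smul c u))"
      using smul_le[of "smul c u" "inverse c"] u False
      by (intro mult_left_mono nn) (simp add: free_space_smul)
    also have "\<dots> = val (c * inverse c) * ?p (smul c u)"
      using val by (auto simp: nonarch_valuation_def)
    also have "\<dots> = ?p (smul c u)" using False nonarch_valuation_simps[OF val] by simp
    finally show ?thesis using smul_le[OF u False] by simp
  qed
  have add: "?p (u + v) \<le> max (?p u) (?p v)"
    if uv: "u \<in> free_space X" "v \<in> free_space X" for u v
  proof (rule field_le_epsilon)
    fix e :: real assume e: "e > 0"
    obtain r where r: "r \<in> ?C u" "r < ?p u + e"
      using cInf_lessD[OF ne[OF uv(1)], of "?p u + e"] e by auto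
    obtain t where t: "t \<in> ?C v" "t < ?p v + e"
      using cInf_lessD[OF ne[OF uv(2)], of "?p v + e"] e by auto
    have "?p (u + v) \<le> max r t" by (intro p_le rep_costs_add r t)
    then show "?p (u + v) \<le> max (?p u) (?p v) + e" using r t by linarith
  qed
  have semi: "ultra_seminorm val X ?p"
    unfolding ultra_seminorm_def using p0 smul_eq add p_ge pos by auto
  have ext: "extends_metric X d ?p"
    unfolding extends_metric_def
  proof (intro ballI antisym)
    fix x y :: "'a \<Rightarrow>\<^sub>0 'f" assume xy: "x \<in> pointed X" "y \<in> pointed X"
    show "?p (x - y) \<le> d x y"
      using p_le[OF rep_costs_diff[OF xy, where c=1]] nonarch_valuation_simps[OF val] by simp
    define w :: "('a \<Rightarrow>\<^sub>0 'f) \<Rightarrow> 'f" where "w a = (if d x a < d x y then 1 else 0)" for a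
    define \<phi> where "\<phi> u = (\<Sum>a\<in>Poly_Mapping.keys u. Poly_Mapping.lookup u a * (w (basis_vec a) - w 0))" for u :: "'a \<Rightarrow>\<^sub>0 'f"
    have \<phi>_eq: "\<phi> u = (\<Sum>a\<in>F. Poly_Mapping.lookup u a * (w (basis_vec a) - w 0))"
      if "finite F" "Poly_Mapping.keys u \<subseteq> F" for u F
      unfolding \<phi>_def using that by (intro sum.mono_neutral_left) (auto simp: in_keys_iff)
    have \<phi>_add: "\<phi> (u + v) = \<phi> u + \<phi> v" for u v
      using keys_add[of u v] \<phi>_eq[of "Poly_Mapping.keys u \<union> Poly_Mapping.keys v"]
      by (simp add: lookup_add distrib_right sum.distrib)
    have \<phi>_smul: "\<phi> (smul c u) = c * \<phi> u" for c u
      using \<phi>_eq[of "Poly_Mapping.keys u" "smul c u"] \<phi>_eq[of "Poly_Mapping.keys u" u]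
      by (simp add: subset_iff in_keys_iff sum_distrib_left mult.assoc)
    have \<phi>_pt: "\<phi> a = w a - w 0" if "a \<in> pointed X" for a
      using that by (auto simp: pointed_def \<phi>_def basis_vec_def)
    have \<phi>_diff: "\<phi> (a - b) = w a - w b" if "a \<in> pointed X" "b \<in> pointed X" for a b
      using \<phi>_add[of "a - b" b] \<phi>_pt that by (simp add: algebra_simps)
    define q where "q u = d x y * val (\<phi> u)" for u
    have dnn: "d a b \<ge> 0" "d a b = d b a" "d a a = 0" if "a \<in> pointed X" "b \<in> pointed X" for a b
      using d that by (auto simp: ultra_pseudometric_on_def)
    have tri: "d a c \<le> max (d a b) (d b c)"
      if "a \<in> pointed X" "b \<in> pointed X" "c \<in> pointed X" for a b c
      using d that by (auto simp: ultra_pseudometric_on_def)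
    have qs: "ultra_seminorm val X q"
      unfolding ultra_seminorm_def
    proof (intro conjI ballI allI)
      show "q u \<ge> 0" for u using dnn xy nn by (simp add: q_def)
      show "q 0 = 0" using nonarch_valuation_simps[OF val] by (simp add: q_def \<phi>_def)
      show "q (smul c u) = val c * q u" for c u
        using val by (simp add: q_def \<phi>_smul nonarch_valuation_def)
      show "q (u + v) \<le> max (q u) (q v)" for u v
      proof -
        have "val (\<phi> u + \<phi> v) \<le> max (val (\<phi> u)) (val (\<phi> v))"
          using val by (auto simp: nonarch_valuation_def)
        then have "val (\<phi> u + \<phi> v) \<le> val (\<phi> u) \<or> val (\<phi> u + \<phi> v) \<le> val (\<phi> v)" by linarith
        then show ?thesis
          using dnn(1)[OF xy] unfolding q_def \<phi>_add by (auto simp: le_max_iff_disj mult_left_mono)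
      qed
    qed
    have qle: "q (a - b) \<le> d a b" if ab: "a \<in> pointed X" "b \<in> pointed X" for a b
    proof -
      have "d x y \<le> d a b" if "w a \<noteq> w b"
        using that tri[OF xy(1) ab] tri[OF xy(1) ab(2,1)] dnn(2)[OF ab]
        by (auto simp: w_def max_def split: if_splits)
      then show ?thesis
        using nonarch_valuation_simps[OF val] dnn(1)[OF ab]
        by (cases "w a = w b") (auto simp: q_def \<phi>_diff[OF ab] w_def split: if_splits)
    qed
    have "q (x - y) = d x y"
      using nonarch_valuation_simps[OF val] dnn[OF xy] dnn(3)[OF xy(1,1)]
      by (auto simp: q_def \<phi>_diff[OF xy] w_def)
    moreover have "x - y \<in> free_space X"
      using xy pointed_subset by (blast intro: free_space_diff)
    ultimately show "d x y \<le> ?p (x - y)"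
      using ultra_seminorm_le_rep_cost[OF val qs qle] by (metis p_ge)
  qed
  have "q u \<le> ?p u" if "ultra_seminorm val X q" "extends_metric X d q" "u \<in> free_space X" for q u
    using ultra_seminorm_le_rep_cost[OF val that(1)] that
    by (intro p_ge) (auto simp: extends_metric_def)
  with semi ext show ?thesis unfolding kantorovich_seminorm_def by blast
qed

end

theory Submission
  imports Defs
begin

text \<open>A closest pair \<open>x\<close>, \<open>y\<close> in a finite set of points can be merged: the weight \<open>f x\<close> is moved
  to \<open>y\<close> at cost \<open>|f x| d(x,y)\<close>. No representation is cheaper than that, because the open ball
  of radius \<open>d(x,y)\<close> around \<open>x\<close> contains no other point of the set, so that the total weight of
  this ball is a linear functional of value \<open>f x\<close>, and any difference \<open>a - b\<close> on which it does not
  vanish has length at least \<open>d(x,y)\<close>. Merging repeatedly inside the support transports the weights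
  optimally.\<close>

section \<open>Representations indexed by finite sets and by matrices\<close>

text \<open>Enumerating \<open>I\<close> reduces this to indices \<open>{1..k}\<close>. It allows
  transport plans, whose natural index set is a set of pairs, to be read as representations.\<close>

lemma rep_costs_finite_sum:
  assumes "finite I" "I \<noteq> {}" "\<And>i. i \<in> I \<Longrightarrow> a i \<in> A \<and> b i \<in> A"
  shows "Max ((\<lambda>i. val (s i) * d (a i) (b i)) ` I)
    \<in> rep_costs val d A (\<Sum>i\<in>I. smul (s i) (a i - b i))"
proof -
  obtain h where h: "bij_betw h {1..card I} I"
    using ex_bij_betw_nat_finite_1[OF assms(1)] by blast
  have img: "h ` {1..card I} = I" using h by (simp add: bij_betw_def)
  have "Max ((\<lambda>i. val (s (h i)) * d (a (h i)) (b (h i))) ` {1..card I})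
    \<in> rep_costs val d A (\<Sum>i\<in>I. smul (s i) (a i - b i))"
  proof (rule rep_costsI)
    show "1 \<le> card I" using assms(1,2) by (simp add: Suc_le_eq card_gt_0_iff)
    show "a (h i) \<in> A \<and> b (h i) \<in> A" if "i \<in> {1..card I}" for i
      using assms(3) img that by blast
    show "(\<Sum>i\<in>I. smul (s i) (a i - b i))
      = (\<Sum>i=1..card I. smul (s (h i)) (a (h i) - b (h i)))"
      by (rule sum.reindex_bij_betw[OF h, symmetric])
  qed
  moreover have "(\<lambda>i. val (s (h i)) * d (a (h i)) (b (h i))) ` {1..card I}
    = (\<lambda>i. val (s i) * d (a i) (b i)) ` I"
    by (subst (2) img[symmetric]) (simp only: image_image)
  ultimately show ?thesis by simp
qed

text \<open>Swapping the indices in the part with \<open>x j\<close> collects the net outflow of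
  each point as its coefficient. This is the link between the two formulas: a matrix with prescribed
  net outflows is the same as a representation by differences.\<close>

lemma sum_matrix_differences:
  fixes x :: "'i \<Rightarrow> ('a \<Rightarrow>\<^sub>0 'f::field)"
  shows "(\<Sum>(i, j)\<in>I \<times> I. smul (c i j) (x i - x j))
    = (\<Sum>i\<in>I. smul ((\<Sum>j\<in>I. c i j) - (\<Sum>j\<in>I. c j i)) (x i))"
proof -
  interpret vector_space "smul :: 'f \<Rightarrow> ('a \<Rightarrow>\<^sub>0 'f) \<Rightarrow> _" by (rule vector_space_smul)
  have "(\<Sum>i\<in>I. \<Sum>j\<in>I. smul (c i j) (x j)) = (\<Sum>i\<in>I. \<Sum>j\<in>I. smul (c j i) (x i))"
    by (rule sum.swap)
  then show ?thesis
    by (simp add: sum.cartesian_product[symmetric] scale_right_diff_distrib sum_subtractf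
        scale_left_diff_distrib scale_sum_left)
qed

section \<open>Comparison of \<open>N\<close> with costs and with other ultra-seminorms\<close>

lemma kantorovich_seminorm_le_rep_cost:
  assumes "nonarch_valuation val" "kantorovich_seminorm val X d N" "A \<subseteq> pointed X"
    "r \<in> rep_costs val d A u"
  shows "N u \<le> r"
proof (rule ultra_seminorm_le_rep_cost[OF assms(1)])
  show "ultra_seminorm val X N" using assms(2) by (simp add: kantorovich_seminorm_def)
  show "N (x - y) \<le> d x y" if "x \<in> pointed X" "y \<in> pointed X" for x y
    using assms(2) that by (simp add: kantorovich_seminorm_def extends_metric_def)
  show "r \<in> rep_costs val d (pointed X) u"
    using assms(3,4) unfolding rep_costs_def by blast
qed

text \<open>Maximality of \<open>N\<close> speaks only of seminorms that agree with
  \<open>d\<close>, whereas \<open>q\<close> is merely dominated by \<open>d\<close>. The infimum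
  formula bridges the gap: \<open>q\<close> lies below every cost, hence below the infimum, and the
  infimum does agree with \<open>d\<close>.\<close>

lemma kantorovich_seminorm_greatest:
  assumes val: "nonarch_valuation val" and d: "ultra_pseudometric_on (pointed X) d"
    and N: "kantorovich_seminorm val X d N" and q: "ultra_seminorm val X q"
    and le: "\<And>x y. x \<in> pointed X \<Longrightarrow> y \<in> pointed X \<Longrightarrow> q (x - y) \<le> d x y"
    and u: "u \<in> free_space X"
  shows "q u \<le> N u"
proof -
  have "q u \<le> Inf (rep_costs val d (pointed X) u)"
    using ultra_seminorm_le_rep_cost[OF val q le]
    by (intro cInf_greatest rep_costs_nonempty[OF u]) blast
  also have "\<dots> \<le> N u"
    using N kantorovich_seminorm_Inf[OF val d] u unfolding kantorovich_seminorm_def by blast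
  finally show ?thesis .
qed

section \<open>Lower bounds for \<open>N\<close> from linear functionals\<close>

text \<open>Linearity forces the value 0 at the zero vector, which is itself one of the points;
  hence the shift by \<open>w 0\<close>. It cancels in differences, where
  \<open>\<phi> (a - b)\<close> is \<open>w a - w b\<close>.\<close>

lemma exists_linear_extension:
  fixes w :: "('a \<Rightarrow>\<^sub>0 'f::field) \<Rightarrow> 'f"
  obtains \<phi> where "\<And>u v. \<phi> (u + v) = \<phi> u + \<phi> v" "\<And>c u. \<phi> (smul c u) = c * \<phi> u"
    "\<And>a. a \<in> pointed UNIV \<Longrightarrow> \<phi> a = w a - w 0"
proof
  define \<phi> where "\<phi> u = (\<Sum>a\<in>Poly_Mapping.keys u.
    Poly_Mapping.lookup u a * (w (basis_vec a) - w 0))" for u :: "'a \<Rightarrow>\<^sub>0 'f"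
  have \<phi>_eq: "\<phi> u = (\<Sum>a\<in>F. Poly_Mapping.lookup u a * (w (basis_vec a) - w 0))"
    if "finite F" "Poly_Mapping.keys u \<subseteq> F" for u F
    unfolding \<phi>_def using that by (intro sum.mono_neutral_left) (auto simp: in_keys_iff)
  show "\<phi> (u + v) = \<phi> u + \<phi> v" for u v
    using keys_add[of u v] \<phi>_eq[of "Poly_Mapping.keys u \<union> Poly_Mapping.keys v"]
    by (simp add: lookup_add distrib_right sum.distrib)
  show "\<phi> (smul c u) = c * \<phi> u" for c u
    using \<phi>_eq[of "Poly_Mapping.keys u" "smul c u"] \<phi>_eq[of "Poly_Mapping.keys u" u]
    by (simp add: subset_iff in_keys_iff sum_distrib_left mult.assoc)
  show "\<phi> a = w a - w 0" if "a \<in> pointed UNIV" for a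
    using that by (auto simp: pointed_def \<phi>_def basis_vec_def)
qed

lemma sum_smul_in_free_space:
  assumes "finite S" "S \<subseteq> free_space X"
  shows "(\<Sum>s\<in>S. smul (f s) s) \<in> free_space X"
  using assms
  by (induction S) (auto intro: free_space_zero free_space_add free_space_smul)

text \<open>The functional measuring the weight of the ball around \<open>x\<close>, scaled by
  \<open>r\<close>, gives an ultra-seminorm dominated by \<open>d\<close>, hence bounded by
  \<open>N\<close>.\<close>

lemma isolated_weight_le_kantorovich_seminorm:
  fixes val :: "'f::field \<Rightarrow> real" and X :: "'a set"
  assumes val: "nonarch_valuation val" and d: "ultra_pseudometric_on (pointed X) d"
    and N: "kantorovich_seminorm val X d N"
    and S: "finite S" "S \<subseteq> pointed X" and f: "sum f S = 0"
    and x: "x \<in> S" and r: "\<And>s. s \<in> S - {x} \<Longrightarrow> r \<le> d x s"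
  shows "val (f x) * r \<le> N (\<Sum>s\<in>S. smul (f s) s)"
proof (cases "r > 0")
  case False
  have nn: "val (f x) \<ge> 0" using val by (simp add: nonarch_valuation_def)
  have "(\<Sum>s\<in>S. smul (f s) s) \<in> free_space X"
    using S pointed_subset by (intro sum_smul_in_free_space) blast+
  then have "0 \<le> N (\<Sum>s\<in>S. smul (f s) s)"
    using N by (auto simp: kantorovich_seminorm_def ultra_seminorm_def)
  moreover have "val (f x) * r \<le> 0" using False nn by (simp add: mult_nonneg_nonpos)
  ultimately show ?thesis by linarith
next
  case rpos: True
  have xP: "x \<in> pointed X" using x S by blast
  \<comment> \<open>The indicator of the open ball of radius \<open>r\<close> around
    \<open>x\<close>; since \<open>r\<close> is positive, it contains \<open>x\<close>.\<close>
  define w :: "('a \<Rightarrow>\<^sub>0 'f) \<Rightarrow> 'f" where "w a = (if d x a < r then 1 else 0)" for a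
  obtain \<phi> where \<phi>: "\<And>u v. \<phi> (u + v) = \<phi> u + \<phi> v" "\<And>c u. \<phi> (smul c u) = c * \<phi> u"
    "\<And>a. a \<in> pointed UNIV \<Longrightarrow> \<phi> a = w a - w 0"
    using exists_linear_extension[of w] by blast
  have \<phi>_pt: "\<phi> a = w a - w 0" if "a \<in> pointed X" for a
    using \<phi>(3)[of a] that by (auto simp: pointed_def)
  have \<phi>_0: "\<phi> 0 = 0" using \<phi>(2)[of 0 0] by simp
  have \<phi>_diff: "\<phi> (a - b) = w a - w b" if "a \<in> pointed X" "b \<in> pointed X" for a b
    using \<phi>(1)[of "a - b" b] \<phi>_pt that by (simp add: algebra_simps)
  have vals: "val 0 = 0" "val 1 = 1" "val (-1) = 1" "\<And>c. val c \<ge> 0"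
    using nonarch_valuation_simps[OF val] val by (auto simp: nonarch_valuation_def)
  define q where "q u = val (\<phi> u) * r" for u
  have q: "ultra_seminorm val X q"
    unfolding ultra_seminorm_def
  proof (intro conjI ballI allI)
    show "q u \<ge> 0" for u using rpos vals by (simp add: q_def)
    show "q 0 = 0" by (simp add: q_def \<phi>_0 vals)
    show "q (smul c u) = val c * q u" for c u
      using val by (simp add: q_def \<phi> nonarch_valuation_def)
    show "q (u + v) \<le> max (q u) (q v)" for u v
    proof -
      have "val (\<phi> u + \<phi> v) \<le> max (val (\<phi> u)) (val (\<phi> v))"
        using val by (auto simp: nonarch_valuation_def)
      then show ?thesis
        using rpos unfolding q_def \<phi> by (auto simp: le_max_iff_disj)
    qed
  qed
  \<comment> \<open>If exactly one of \<open>a\<close> and \<open>b\<close> lies in the ball, the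
    ultrametric inequality forces \<open>r\<close> \<le> \<open>d a b\<close>, and
    \<open>val\<close> is 1 at both 1 and -1. Otherwise \<open>q (a - b)\<close> is 0.\<close>
  have q_le: "q (a - b) \<le> d a b" if ab: "a \<in> pointed X" "b \<in> pointed X" for a b
  proof -
    have "d x b \<le> max (d x a) (d a b)" "d x a \<le> max (d x b) (d b a)" "d a b = d b a" "d a b \<ge> 0"
      using d ab xP unfolding ultra_pseudometric_on_def by blast+
    then show ?thesis
      using vals by (auto simp: q_def \<phi>_diff[OF ab] w_def)
  qed
  have "\<phi> (\<Sum>s\<in>T. smul (f s) s) = (\<Sum>s\<in>T. f s * (w s - w 0))"
    if "finite T" "T \<subseteq> pointed X" for T
    using that by (induction T) (simp_all add: \<phi> \<phi>_0 \<phi>_pt)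
  then have "\<phi> (\<Sum>s\<in>S. smul (f s) s) = (\<Sum>s\<in>S. f s * w s) - sum f S * w 0"
    using S by (simp add: right_diff_distrib sum_subtractf sum_distrib_right)
  also have "\<dots> = (\<Sum>s\<in>S. if s = x then f x else 0)"
  proof -
    \<comment> \<open>By the choice of \<open>r\<close> the ball meets \<open>S\<close> in
      \<open>x\<close> alone. The term with \<open>w 0\<close> disappears because the total weight
      is zero.\<close>
    have "f s * w s = (if s = x then f x else 0)" if "s \<in> S" for s
      using r[of s] that rpos d xP by (auto simp: w_def ultra_pseudometric_on_def)
    then show ?thesis using f by simp
  qed
  also have "\<dots> = f x" using x S by simp
  finally have "q (\<Sum>s\<in>S. smul (f s) s) = val (f x) * r" by (simp add: q_def)
  moreover have "(\<Sum>s\<in>S. smul (f s) s) \<in> free_space X"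
    using S pointed_subset by (intro sum_smul_in_free_space) blast+
  ultimately show ?thesis
    using kantorovich_seminorm_greatest[OF val d N q q_le] by metis
qed

section \<open>Optimal transport on a finite set of points\<close>

text \<open>The entry \<open>c a b\<close> is the mass sent from \<open>a\<close> to
  \<open>b\<close>. Induction on the number of points: the plan for \<open>S\<close> without
  \<open>x\<close>, with the weight of \<open>x\<close> added to \<open>y\<close>, is completed by
  one transfer from \<open>x\<close> to \<open>y\<close>.\<close>

lemma exists_optimal_transport:
  fixes val :: "'f::field \<Rightarrow> real" and X :: "'a set"
  assumes val: "nonarch_valuation val" and d: "ultra_pseudometric_on (pointed X) d"
    and N: "kantorovich_seminorm val X d N"
    and "finite S" "S \<subseteq> pointed X" "sum f S = 0"
  shows "\<exists>c. (\<forall>a\<in>S. c a a = 0) \<and>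
    (\<forall>a\<in>S. (\<Sum>b\<in>S. c a b) - (\<Sum>b\<in>S. c b a) = f a) \<and>
    (\<forall>a\<in>S. \<forall>b\<in>S. val (c a b) * d a b \<le> N (\<Sum>s\<in>S. smul (f s) s))"
  using assms(4-6)
proof (induction "card S" arbitrary: S f rule: less_induct)
  case less
  interpret vector_space "smul :: 'f \<Rightarrow> ('a \<Rightarrow>\<^sub>0 'f) \<Rightarrow> _" by (rule vector_space_smul)
  have vals: "val 0 = 0" "\<And>c. val c \<ge> 0"
    using nonarch_valuation_simps[OF val] val by (auto simp: nonarch_valuation_def)
  have semi: "ultra_seminorm val X N" and ext: "extends_metric X d N"
    using N by (auto simp: kantorovich_seminorm_def)
  have in_free: "(\<Sum>s\<in>T. smul (g s) s) \<in> free_space X"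
    if "finite T" "T \<subseteq> pointed X" for T and g :: "('a \<Rightarrow>\<^sub>0 'f) \<Rightarrow> 'f"
    using that pointed_subset by (intro sum_smul_in_free_space) blast+
  have N_nonneg: "N (\<Sum>s\<in>S. smul (f s) s) \<ge> 0"
    using semi in_free[OF less.prems(1,2)] by (simp add: ultra_seminorm_def)
  define D where "D = S \<times> S - Id"
  show ?case
  proof (cases "D = {}")
    case True
    \<comment> \<open>At most one point remains, and its weight equals the total weight, which is
      zero.\<close>
    then have "a = b" if "a \<in> S" "b \<in> S" for a b using that by (auto simp: D_def)
    moreover have "f a = 0" if "a \<in> S" for a
    proof -
      have "S = {a}" using that True by (auto simp: D_def)
      then show ?thesis using less.prems(3) by simp
    qed
    ultimately show ?thesis
      using N_nonneg vals by (intro exI[of _ "\<lambda>_ _. 0"]) auto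
  next
    case False
    have "finite D" using less.prems(1) by (simp add: D_def)
    then obtain z where z: "z \<in> D" "\<forall>t\<in>D. case_prod d z \<le> case_prod d t"
      using False arg_min_if_finite[of D "case_prod d"] by (metis not_le)
    obtain x y where z_eq: "z = (x, y)" by (cases z)
    have xy: "x \<in> S" "y \<in> S" "x \<noteq> y" using z(1) by (auto simp: z_eq D_def)
    \<comment> \<open>Minimality over all pairs is used only through the distances from
      \<open>x\<close>: this is what makes \<open>d x y\<close> an admissible radius for isolating
      \<open>x\<close>.\<close>
    have closest: "d x y \<le> d x s" if "s \<in> S - {x}" for s
      using bspec[OF z(2), of "(x, s)"] that xy(1) by (auto simp: z_eq D_def)
    define u where "u = (\<Sum>s\<in>S. smul (f s) s)"
    have move_le: "val (f x) * d x y \<le> N u"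
      unfolding u_def
      using less.prems xy closest by (intro isolated_weight_le_kantorovich_seminorm[OF val d N])
    define T where "T = S - {x}"
    define g where "g = f(y := f x + f y)"
    have T: "finite T" "T \<subseteq> pointed X" "y \<in> T" "x \<notin> T" "card T < card S" and S: "S = insert x T"
      using less.prems xy by (auto simp: T_def simp del: card_Diff_insert card_Diff_singleton intro: card_Diff1_less)
    have split_f: "sum f S = f x + (f y + sum f (T - {y}))"
      using T by (simp add: S sum.remove[OF T(1,3)])
    have split_g: "sum g T = f x + f y + sum f (T - {y})"
      using T by (simp add: sum.remove[OF T(1,3)] g_def)
    have "sum g T = 0" using split_f split_g less.prems(3) by (simp add: add.assoc)
    from less.hyps[OF T(5,1,2) this] obtain c where
      c: "\<And>a. a \<in> T \<Longrightarrow> c a a = 0" "\<And>a. a \<in> T \<Longrightarrow> (\<Sum>b\<in>T. c a b) - (\<Sum>b\<in>T. c b a) = g a"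
        "\<And>a b. a \<in> T \<Longrightarrow> b \<in> T \<Longrightarrow> val (c a b) * d a b \<le> N (\<Sum>s\<in>T. smul (g s) s)"
      by blast
    define v where "v = (\<Sum>s\<in>T. smul (g s) s)"
    have "v = smul (f x + f y) y + (\<Sum>s\<in>T - {y}. smul (f s) s)"
      unfolding v_def using T by (simp add: sum.remove[OF T(1,3)] g_def)
    moreover have "u = smul (f x) x + (smul (f y) y + (\<Sum>s\<in>T - {y}. smul (f s) s))"
      unfolding u_def using T by (simp add: S sum.remove[OF T(1,3)])
    \<comment> \<open>The merge adds a single difference of seminorm
      \<open>val (f x) * d x y\<close>, at most \<open>N u\<close> by \<open>move_le\<close>. The
      ultrametric inequality therefore yields \<open>N v\<close> \<le> \<open>N u\<close>, with no
      loss accumulating along the induction.\<close>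
    ultimately have v: "v = u + smul (f x) (y - x)"
      by (simp add: scale_left_distrib scale_right_diff_distrib)
    have yx: "y \<in> pointed X" "x \<in> pointed X" using xy less.prems(2) by auto
    then have yx_free: "y - x \<in> free_space X"
      using pointed_subset by (blast intro: free_space_diff)
    have "N (smul (f x) (y - x)) = val (f x) * d x y"
      using semi yx_free ext yx d
      by (simp add: ultra_seminorm_def extends_metric_def ultra_pseudometric_on_def)
    moreover have "N v \<le> max (N u) (N (smul (f x) (y - x)))"
      unfolding v using semi in_free[OF less.prems(1,2)] free_space_smul[OF yx_free]
      by (simp add: ultra_seminorm_def u_def)
    ultimately have Nv: "N v \<le> N u" using move_le by simp
    \<comment> \<open>The point \<open>x\<close> sends its whole weight to \<open>y\<close> and
      receives nothing. The extra inflow at \<open>y\<close> lowers its net outflow from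
      \<open>f x + f y\<close> to \<open>f y\<close>; the other points of \<open>T\<close> keep
      theirs.\<close>
    define e where "e a b = (if a = x then if b = y then f x else 0
      else if b = x then 0 else c a b)" for a b
    have e_x: "(\<Sum>b\<in>T. e x b) = f x" "\<And>a. a \<in> T \<Longrightarrow> e a x = 0" "e x x = 0"
      using T xy by (auto simp: e_def)
    have e_T: "e a b = c a b" if "a \<in> T" "b \<in> T" for a b
      using that T by (auto simp: e_def)
    show ?thesis
    proof (intro exI[of _ e] conjI ballI)
      fix a assume a: "a \<in> S"
      show "e a a = 0" using a c(1) e_x(3) e_T by (auto simp: S)
      show "(\<Sum>b\<in>S. e a b) - (\<Sum>b\<in>S. e b a) = f a"
      proof (cases "a = x")
        case True
        then show ?thesis using T e_x by (simp add: S)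
      next
        case False
        then have "a \<in> T" using a by (simp add: S)
        then have "(\<Sum>b\<in>S. e a b) - (\<Sum>b\<in>S. e b a) = (\<Sum>b\<in>T. c a b) - (e x a + (\<Sum>b\<in>T. c b a))"
          using T e_x e_T by (simp add: S)
        also have "\<dots> = g a - e x a" using c(2)[OF \<open>a \<in> T\<close>] by (simp add: algebra_simps)
        also have "\<dots> = f a" by (simp add: g_def e_def)
        finally show ?thesis .
      qed
      fix b assume b: "b \<in> S"
      show "val (e a b) * d a b \<le> N (\<Sum>s\<in>S. smul (f s) s)"
        using a b c(3)[of a b] Nv N_nonneg move_le vals(1)
        unfolding S[symmetric] u_def[symmetric] v_def[symmetric]
        by (auto simp: e_def S)
    qed
  qed
qed

section \<open>Supports and normal forms\<close>

lemma inj_basis_vec: "inj (basis_vec :: 'a \<Rightarrow> ('a \<Rightarrow>\<^sub>0 'f::field))"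
  by (auto simp: inj_def basis_vec_def dest!: arg_cong[of _ _ Poly_Mapping.keys])

lemma basis_vec_neq_0: "basis_vec a \<noteq> (0 :: 'a \<Rightarrow>\<^sub>0 'f::field)"
  by (auto simp: basis_vec_def dest!: arg_cong[of _ _ Poly_Mapping.keys])

lemma supp_bounds:
  "basis_vec ` Poly_Mapping.keys u \<subseteq> supp u" "supp u \<subseteq> insert 0 (basis_vec ` Poly_Mapping.keys u)"
  by (auto simp: supp_def)

lemma finite_supp: "finite (supp u)"
  using finite_subset[OF supp_bounds(2)] by simp

lemma supp_nonempty: "supp u \<noteq> {}"
  by (auto simp: supp_def)

lemma supp_subset_pointed: "u \<in> free_space X \<Longrightarrow> supp u \<subseteq> pointed X"
  using supp_bounds(2)[of u] by (auto simp: free_space_def pointed_def)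

text \<open>Giving \<open>0\<close> the weight \<open>- coeff_sum u\<close> balances the total
  without changing the vector. Where \<open>0\<close> is missing from the support, the coefficients
  already sum to zero. This is the balanced form that the transport lemma requires.\<close>

lemma supp_weights:
  fixes u :: "'a \<Rightarrow>\<^sub>0 'f::field"
  obtains f where "u = (\<Sum>s\<in>supp u. smul (f s) s)" "sum f (supp u) = 0"
    "\<And>a. f (basis_vec a) = Poly_Mapping.lookup u a"
proof
  define f where "f s = (if s = 0 then - coeff_sum u
    else Poly_Mapping.lookup u (inv basis_vec s))" for s :: "'a \<Rightarrow>\<^sub>0 'f"
  show f: "f (basis_vec a) = Poly_Mapping.lookup u a" for a
    by (simp add: f_def basis_vec_neq_0 inv_f_f[OF inj_basis_vec])
  let ?B = "basis_vec ` Poly_Mapping.keys u :: ('a \<Rightarrow>\<^sub>0 'f) set"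
  have inj: "inj_on (basis_vec :: 'a \<Rightarrow> ('a \<Rightarrow>\<^sub>0 'f)) A" for A
    using inj_basis_vec by (rule inj_on_subset) simp
  have zero: "0 \<notin> ?B" by (metis basis_vec_neq_0 imageE)
  have sum_B: "sum f ?B = coeff_sum u"
    by (simp add: sum.reindex[OF inj] f coeff_sum_def)
  show "sum f (supp u) = 0"
    using zero sum_B by (simp add: supp_def f_def[of 0]) (simp add: coeff_sum_def)
  have "(\<Sum>s\<in>supp u. smul (f s) s) = (\<Sum>s\<in>?B. smul (f s) s)"
    using supp_bounds[of u] finite_supp[of u] by (intro sum.mono_neutral_right) auto
  also have "\<dots> = (\<Sum>a\<in>Poly_Mapping.keys u. smul (Poly_Mapping.lookup u a) (basis_vec a))"
    by (simp add: sum.reindex[OF inj] f)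
  also have "\<dots> = u"
    by (rule poly_mapping_eqI)
      (simp add: lookup_sum basis_vec_def lookup_single when_def
        if_distrib[of "(*) _"] in_keys_iff cong: if_cong)
  finally show "u = (\<Sum>s\<in>supp u. smul (f s) s)" by simp
qed

lemma normal_form_basis_vec:
  assumes "normal_form X u n lam x" "i \<in> {1..n}"
  obtains a where "x i = basis_vec a"
  using assms unfolding normal_form_def by blast

lemma normal_form_lookup:
  assumes nf: "normal_form X u n lam x" and i: "i \<in> {1..n}" and a: "x i = basis_vec a"
  shows "Poly_Mapping.lookup u a = lam i"
proof -
  have "lam j * Poly_Mapping.lookup (x j) a = (if j = i then lam i else 0)" if "j \<in> {1..n}" for j
  proof -
    obtain b where b: "x j = basis_vec b" using normal_form_basis_vec[OF nf \<open>j \<in> _\<close>] .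
    have "j = i \<longleftrightarrow> b = a"
      using nf inj_on_eq_iff[of x "{1..n}" j i] that i a b
      by (simp add: normal_form_def inj_eq[OF inj_basis_vec])
    then show ?thesis by (auto simp: b basis_vec_def lookup_single when_def)
  qed
  then have "Poly_Mapping.lookup u a = (\<Sum>j=1..n. if j = i then lam i else 0)"
    using nf by (simp add: normal_form_def lookup_sum)
  then show ?thesis using i by simp
qed

text \<open>Coefficients of a normal form are nonzero, so each \<open>x i\<close> comes from a key
  of \<open>u\<close>. Conversely, at a key some summand is nonzero, and a basis vector is nonzero
  only at its own index.\<close>

lemma normal_form_image:
  fixes u :: "'a \<Rightarrow>\<^sub>0 'f::field"
  assumes nf: "normal_form X u n lam x"
  shows "x ` {1..n} = basis_vec ` Poly_Mapping.keys u"
proof (intro equalityI subsetI)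
  fix v assume "v \<in> x ` {1..n}"
  then obtain i where i: "i \<in> {1..n}" "v = x i" by blast
  obtain a where a: "x i = basis_vec a" using normal_form_basis_vec[OF nf i(1)] .
  show "v \<in> basis_vec ` Poly_Mapping.keys u"
    using normal_form_lookup[OF nf i(1) a] nf i a by (auto simp: normal_form_def in_keys_iff)
next
  fix v :: "'a \<Rightarrow>\<^sub>0 'f"
  assume "v \<in> basis_vec ` Poly_Mapping.keys u"
  then obtain a where a: "v = basis_vec a" "Poly_Mapping.lookup u a \<noteq> 0"
    by (auto simp: in_keys_iff)
  have "(\<Sum>i=1..n. lam i * Poly_Mapping.lookup (x i) a) \<noteq> 0"
    using a(2) nf by (simp add: normal_form_def lookup_sum)
  then obtain i where i: "i \<in> {1..n}" "Poly_Mapping.lookup (x i) a \<noteq> 0"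
    using sum.neutral[of "{1..n}" "\<lambda>i. lam i * Poly_Mapping.lookup (x i) a"] by force
  moreover obtain b where "x i = basis_vec b" using normal_form_basis_vec[OF nf i(1)] .
  ultimately have "v = x i"
    by (auto simp: a(1) basis_vec_def lookup_single when_def split: if_splits)
  then show "v \<in> x ` {1..n}" using i(1) by blast
qed

text \<open>A surjection between finite sets of equal cardinality is injective.\<close>

lemma inj_on_enumeration:
  assumes "m = card S" "S = x ` {1..m}"
  shows "inj_on x {1..m}"
proof (rule eq_card_imp_inj_on)
  show "card (x ` {1..m}) = card {1..m}"
    unfolding assms(2)[symmetric] by (simp add: assms(1)[symmetric])
qed simp

section \<open>The two minima\<close>

text \<open>The entries of an admissible matrix are the coefficients of a representation of
  \<open>u\<close> over pairs of support points. The net outflow is prescribed only up to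
  \<open>n\<close>, but any later index belongs to the zero vector, so its coefficient does not
  affect the sum.\<close>

lemma matrix_costs_subset_rep_costs:
  assumes nf: "normal_form X u n lam x" and m: "m = card (supp u)" "supp u = x ` {1..m}"
  shows "matrix_costs val d n lam m x \<subseteq> rep_costs val d (supp u) u"
proof
  interpret vector_space "smul :: 'b \<Rightarrow> ('a \<Rightarrow>\<^sub>0 'b) \<Rightarrow> _" by (rule vector_space_smul)
  fix t assume "t \<in> matrix_costs val d n lam m x"
  then obtain c where
    t: "t = Max ((\<lambda>(i, j). val (c i j) * d (x i) (x j)) ` ({1..m} \<times> {1..m}))"
    and c: "\<And>i. i \<in> {1..n} \<Longrightarrow> (\<Sum>j=1..m. c i j) - (\<Sum>j=1..m. c j i) = lam i"
    unfolding matrix_costs_def by blast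
  have inj: "inj_on x {1..m}" using inj_on_enumeration[OF m] .
  have "n = card (x ` {1..n})" using nf by (simp add: normal_form_def card_image)
  also have "\<dots> \<le> m"
    unfolding m(1) normal_form_image[OF nf] by (intro card_mono finite_supp supp_bounds)
  finally have "n \<le> m" .
  \<comment> \<open>The first \<open>n\<close> indices already exhaust the basis vectors in the
    support, and the enumeration has no repetitions, so only \<open>0\<close> is left.\<close>
  have "x i = 0" if "i \<in> {1..m} - {1..n}" for i
  proof -
    have "x i \<notin> x ` {1..n}" using inj that \<open>n \<le> m\<close> by (auto dest: inj_onD)
    moreover have "x i \<in> supp u" using m(2) that by auto
    ultimately show ?thesis using supp_bounds(2) normal_form_image[OF nf] by blast
  qed
  then have "(\<Sum>i=1..m. smul ((\<Sum>j=1..m. c i j) - (\<Sum>j=1..m. c j i)) (x i))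
    = (\<Sum>i=1..n. smul ((\<Sum>j=1..m. c i j) - (\<Sum>j=1..m. c j i)) (x i))"
    using \<open>n \<le> m\<close> by (intro sum.mono_neutral_right) auto
  also have "\<dots> = u" using c nf by (simp add: normal_form_def)
  finally have u: "(\<Sum>(i, j)\<in>{1..m} \<times> {1..m}. smul (c i j) (x i - x j)) = u"
    by (simp add: sum_matrix_differences)
  have "{1..m} \<noteq> {}" using m(2) supp_nonempty by blast
  then have "Max ((\<lambda>p. val (case_prod c p) * d (x (fst p)) (x (snd p))) ` ({1..m} \<times> {1..m}))
    \<in> rep_costs val d (supp u)
      (\<Sum>p\<in>{1..m} \<times> {1..m}. smul (case_prod c p) (x (fst p) - x (snd p)))"
    using m(2) by (intro rep_costs_finite_sum) auto
  then show "t \<in> rep_costs val d (supp u) u"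
    using u by (simp add: t case_prod_beta)
qed

theorem corollary5p7:
  fixes val :: "'f::field \<Rightarrow> real"
    and X :: "'a set"
    and d :: "('a \<Rightarrow>\<^sub>0 'f) \<Rightarrow> ('a \<Rightarrow>\<^sub>0 'f) \<Rightarrow> real"
    and N :: "('a \<Rightarrow>\<^sub>0 'f) \<Rightarrow> real"
  assumes "nonarch_valuation val"
    and "X \<noteq> {}"
    and "ultra_pseudometric_on (pointed X) d"
    and "kantorovich_seminorm val X d N"
  shows "\<forall>u\<in>free_space X.
    is_minimum (N u) (rep_costs val d (supp u) u) \<and>
    (\<forall>n lam m x. normal_form X u n lam x \<and> m = card (supp u) \<and> supp u = x ` {1..m} \<longrightarrow>
       is_minimum (N u) (matrix_costs val d n lam m x))"
proof (intro ballI conjI allI impI)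
  fix u :: "'a \<Rightarrow>\<^sub>0 'f" assume u: "u \<in> free_space X"
  note val = assms(1) and d = assms(3) and N = assms(4)
  note S = finite_supp[of u] supp_subset_pointed[OF u]
  have lower: "N u \<le> t" if "t \<in> rep_costs val d (supp u) u" for t
    by (rule kantorovich_seminorm_le_rep_cost[OF val N S(2) that])
  obtain f where f: "u = (\<Sum>s\<in>supp u. smul (f s) s)" "sum f (supp u) = 0"
    "\<And>a. f (basis_vec a) = Poly_Mapping.lookup u a"
    using supp_weights[of u] by blast
  \<comment> \<open>This one plan on the support attains both minima: all its entries cost at most
    \<open>N u\<close>, while \<open>lower\<close> bounds every cost from below.\<close>
  obtain c where c: "\<And>a. a \<in> supp u \<Longrightarrow> c a a = 0"
    "\<And>a. a \<in> supp u \<Longrightarrow> (\<Sum>b\<in>supp u. c a b) - (\<Sum>b\<in>supp u. c b a) = f a"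
    "\<And>a b. a \<in> supp u \<Longrightarrow> b \<in> supp u \<Longrightarrow> val (c a b) * d a b \<le> N u"
    using exists_optimal_transport[OF val d N S f(2)] unfolding f(1)[symmetric] by blast
  show "is_minimum (N u) (rep_costs val d (supp u) u)"
  proof -
    let ?M = "Max ((\<lambda>p. val (case_prod c p) * d (fst p) (snd p)) ` (supp u \<times> supp u))"
    have "?M \<in> rep_costs val d (supp u)
      (\<Sum>p\<in>supp u \<times> supp u. smul (case_prod c p) (fst p - snd p))"
      using S(1) supp_nonempty[of u] by (intro rep_costs_finite_sum) auto
    also have "(\<Sum>p\<in>supp u \<times> supp u. smul (case_prod c p) (fst p - snd p))
      = (\<Sum>a\<in>supp u. smul (f a) a)"
      using sum_matrix_differences[of c "\<lambda>a. a" "supp u"] c(2) by (simp add: case_prod_beta)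
    finally have M: "?M \<in> rep_costs val d (supp u) u"
      by (simp only: f(1)[symmetric])
    moreover have "?M \<le> N u" using S(1) supp_nonempty[of u] c(3) by simp
    ultimately show ?thesis using lower by (force simp: is_minimum_def)
  qed
  fix n lam m x
  assume "normal_form X u n lam x \<and> m = card (supp u) \<and> supp u = x ` {1..m}"
  then have nf: "normal_form X u n lam x" and m: "m = card (supp u)" "supp u = x ` {1..m}"
    by blast+
  show "is_minimum (N u) (matrix_costs val d n lam m x)"
  proof -
    have inj: "inj_on x {1..m}" using inj_on_enumeration[OF m] .
    have reindex: "(\<Sum>j=1..m. h (x j)) = sum h (supp u)" for h :: "('a \<Rightarrow>\<^sub>0 'f) \<Rightarrow> 'f"
      by (simp only: m(2) sum.reindex[OF inj] o_def)
    have ne: "{1..m} \<noteq> {}" using m(2) supp_nonempty[of u] by blast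
    define M where "M = Max ((\<lambda>(i, j). val (c (x i) (x j)) * d (x i) (x j)) ` ({1..m} \<times> {1..m}))"
    \<comment> \<open>For \<open>i\<close> up to \<open>n\<close> the point \<open>x i\<close> is a
      basis vector, so its weight under \<open>f\<close> is the coefficient
      \<open>lam i\<close>.\<close>
    have "(\<Sum>j=1..m. c (x i) (x j)) - (\<Sum>j=1..m. c (x j) (x i)) = lam i" if i: "i \<in> {1..n}" for i
    proof -
      obtain a where a: "x i = basis_vec a" using normal_form_basis_vec[OF nf i] .
      have "x i \<in> supp u" using normal_form_image[OF nf] supp_bounds(1)[of u] i by blast
      from c(2)[OF this] have "(\<Sum>j=1..m. c (x i) (x j)) - (\<Sum>j=1..m. c (x j) (x i)) = f (x i)"
        unfolding reindex[of "c (x i)"] reindex[of "\<lambda>b. c b (x i)"] .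
      also have "\<dots> = lam i" unfolding a f(3) by (rule normal_form_lookup[OF nf i a])
      finally show ?thesis .
    qed
    moreover have in_supp: "x i \<in> supp u" if "i \<in> {1..m}" for i
      unfolding m(2) using that by (rule imageI)
    ultimately have "M \<in> matrix_costs val d n lam m x"
      unfolding matrix_costs_def M_def
      by (intro CollectI exI[of _ "\<lambda>i j. c (x i) (x j)"] conjI refl ballI c(1))
    moreover have "M \<le> N u"
      unfolding M_def
    proof (rule Max.boundedI)
      show "t \<le> N u" if "t \<in> (\<lambda>(i, j). val (c (x i) (x j)) * d (x i) (x j)) ` ({1..m} \<times> {1..m})" for t
        using that c(3)[OF in_supp in_supp] by (auto simp del: atLeastAtMost_iff)
    qed (use ne in simp_all)
    \<comment> \<open>Matrix costs are representation costs over the support, so the bound for the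
      first formula carries over.\<close>
    moreover have lower': "N u \<le> t" if "t \<in> matrix_costs val d n lam m x" for t
      by (rule lower[OF subsetD[OF matrix_costs_subset_rep_costs[OF nf m] that]])
    ultimately have "M = N u" by (metis antisym)
    with \<open>M \<in> _\<close> lower' show ?thesis unfolding is_minimum_def by metis
  qed
qed

end
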